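(* Let $G$ be a bi-directed graph with finite vertex set $V$, and let $\le$ be a total order on $V$ that extends the partial order $\preccurlyeq_B$ (i.e. $\mathrm{Bd}(v)\subsetneq \mathrm{Bd}(w)$ implies $v<w$). Then the graph $G^{\min}_<$ obtained from $G$ and $\le$ by the construction described in the context is a minimally oriented graph of $G$.
   Context: A simple mixed graph $G=(V,E)$ has a finite vertex set $V$ and at most one edge between any two distinct vertices (no loops), each edge being undirected ($v-w$), directed ($v\to w$ or $v\leftarrow w$), or bi-directed ($v\leftrightarrow w$). An edge $v\leftarrow w$ or $v\leftrightarrow w$ has an arrowhead at $v$; an edge $v\to w$ or $v-w$ has a tail at $v$. A bi-directed (undirected, directed) graph has only bi-directed (undirected, directed) edges. Vertices are adjacent if joined by an edge of any type; $\mathrm{Bd}(v)$ is the set consisting of $v$ and all vertices adjacent to $v$. A path is a sequence of distinct vertices with consecutive ones adjacent. $v$ is an ancestor of $w$ if $v=w$ or there is a directed path $v\to\cdots\to w$; $\mathrm{An}(C)$ is the set of ancestors of elements of $C$. Ancestral graph: a simple mixed graph such that (i) there are no directed cycles; (ii) if $v-w\in G$ then there is no $u$ with $u\to v\in G$ or $u\leftrightarrow v\in G$; (iii) if $v\leftrightarrow w\in G$ then $v$ is not an ancestor of $w$. m-separation: a non-endpoint vertex on a path is a collider if both path edges at it have an arrowhead at it, otherwise a non-collider. A path between $v$ and $w$ is $m$-connecting given $C\subseteq V\setminus\{v,w\}$ if every non-collider on it is not in $C$ and every collider on it is in $\mathrm{An}(C)$. $v,w$ are $m$-separated given $C$ if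 no path $m$-connects them given $C$; disjoint non-empty sets $A,B$ are $m$-separated given $C\subseteq V\setminus(A\cup B)$ if every $v\in A$ and $w\in B$ are. An ancestral graph is maximal if for every pair of distinct non-adjacent vertices $v,w$ there is some $C\subseteq V\setminus\{v,w\}$ such that $v,w$ are $m$-separated given $C$. Two ancestral graphs on the same vertex set are Markov equivalent if they have the same $m$-separations (the same triples $(A,B,C)$ with $A,B$ $m$-separated given $C$). Minimally oriented graph of a bi-directed graph $G$: a graph $G^{\min}$ such that (i) $G^{\min}$ is a maximal ancestral graph; (ii) $G$ and $G^{\min}$ are Markov equivalent; (iii) $G^{\min}$ has the minimum number of arrowheads among all maximal ancestral graphs Markov equivalent to $G$, where the number of arrowheads of a graph with $d$ directed and $b$ bi-directed edges is $d+2b$. Simplicial graph: a vertex $v$ is simplicial if every two distinct vertices of $\mathrm{Bd}(v)$ are adjacent. Dropping the arrowhead at $v$ means replacing $v\leftarrow w$ by $v-w$, or $v\leftrightarrow w$ by $v\to w$. The simplicial graph $G^s$ of a bi-directed graph $G$ is obtained by dropping all arrowheads at simplicial vertices of $G$. Partial order: $v\preccurlyeq_B w$ iff $v=w$ or $\mathrm{Bd}(v)\subsetneq\mathrm{Bd}(w)$ in $G$. Construction of $G^{\min}_<$: start with $G^s$ and replace every bi-directed edge $v\leftrightarrow w$ of $G^s$ with $\mathrm{Bd}(v)\subseteq\mathrm{Bd}(w)$ and $v<w$ by the directed edge $v\to w$. *)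

theory Defs
  imports Main
begin

text \<open>Undirected and bi-directed edges are unordered pairs, so each of them is counted once by
  \<^const>\<open>card\<close>; a directed edge from v to w is the ordered pair (v, w).\<close>

record 'a mixed_graph =
  verts :: "'a set"
  undir_edges :: "'a set set"
  dir_edges :: "('a \<times> 'a) set"
  bidir_edges :: "'a set set"

definition simple_mixed_graph :: "'a mixed_graph \<Rightarrow> bool" where
  "simple_mixed_graph G \<longleftrightarrow>
     finite (verts G) \<and>
     (\<forall>e \<in> undir_edges G \<union> bidir_edges G. \<exists>v\<in>verts G. \<exists>w\<in>verts G. v \<noteq> w \<and> e = {v, w}) \<and>
     (\<forall>(v, w) \<in> dir_edges G. v \<in> verts G \<and> w \<in> verts G \<and> v \<noteq> w) \<and>
     undir_edges G \<inter> bidir_edges G = {} \<and>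
     (\<forall>(v, w) \<in> dir_edges G.
        (w, v) \<notin> dir_edges G \<and> {v, w} \<notin> undir_edges G \<and> {v, w} \<notin> bidir_edges G)"

definition bidirected_graph :: "'a mixed_graph \<Rightarrow> bool" where
  "bidirected_graph G \<longleftrightarrow> simple_mixed_graph G \<and> undir_edges G = {} \<and> dir_edges G = {}"

definition adjacent :: "'a mixed_graph \<Rightarrow> 'a \<Rightarrow> 'a \<Rightarrow> bool" where
  "adjacent G v w \<longleftrightarrow>
     {v, w} \<in> undir_edges G \<or> (v, w) \<in> dir_edges G \<or> (w, v) \<in> dir_edges G \<or> {v, w} \<in> bidir_edges G"

definition Bd :: "'a mixed_graph \<Rightarrow> 'a \<Rightarrow> 'a set" where
  "Bd G v = insert v {w. adjacent G v w}"

text \<open>The edge between v and w has an arrowhead at its first-named endpoint v.\<close>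

definition arrowhead_at :: "'a mixed_graph \<Rightarrow> 'a \<Rightarrow> 'a \<Rightarrow> bool" where
  "arrowhead_at G v w \<longleftrightarrow> (w, v) \<in> dir_edges G \<or> {v, w} \<in> bidir_edges G"

definition path_between :: "'a mixed_graph \<Rightarrow> 'a \<Rightarrow> 'a list \<Rightarrow> 'a \<Rightarrow> bool" where
  "path_between G v p w \<longleftrightarrow>
     p \<noteq> [] \<and> hd p = v \<and> last p = w \<and> set p \<subseteq> verts G \<and> distinct p \<and> successively (adjacent G) p"

definition ancestor :: "'a mixed_graph \<Rightarrow> 'a \<Rightarrow> 'a \<Rightarrow> bool" where
  "ancestor G v w \<longleftrightarrow> (v, w) \<in> (dir_edges G)\<^sup>*"

definition An :: "'a mixed_graph \<Rightarrow> 'a set \<Rightarrow> 'a set" where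
  "An G C = {v. \<exists>w\<in>C. ancestor G v w}"

definition ancestral_graph :: "'a mixed_graph \<Rightarrow> bool" where
  "ancestral_graph G \<longleftrightarrow>
     simple_mixed_graph G \<and>
     acyclic (dir_edges G) \<and>
     (\<forall>v w. {v, w} \<in> undir_edges G \<longrightarrow>
        \<not> (\<exists>u. (u, v) \<in> dir_edges G \<or> {u, v} \<in> bidir_edges G)) \<and>
     (\<forall>v w. {v, w} \<in> bidir_edges G \<longrightarrow> \<not> ancestor G v w)"

definition collider :: "'a mixed_graph \<Rightarrow> 'a list \<Rightarrow> nat \<Rightarrow> bool" where
  "collider G p i \<longleftrightarrow>
     arrowhead_at G (p ! i) (p ! (i - 1)) \<and> arrowhead_at G (p ! i) (p ! (i + 1))"

definition m_connecting :: "'a mixed_graph \<Rightarrow> 'a set \<Rightarrow> 'a list \<Rightarrow> bool" where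
  "m_connecting G C p \<longleftrightarrow>
     (\<forall>i. 0 < i \<and> i + 1 < length p \<longrightarrow>
        (\<not> collider G p i \<longrightarrow> p ! i \<notin> C) \<and> (collider G p i \<longrightarrow> p ! i \<in> An G C))"

definition m_separated :: "'a mixed_graph \<Rightarrow> 'a \<Rightarrow> 'a \<Rightarrow> 'a set \<Rightarrow> bool" where
  "m_separated G v w C \<longleftrightarrow> \<not> (\<exists>p. path_between G v p w \<and> m_connecting G C p)"

definition m_separations :: "'a mixed_graph \<Rightarrow> ('a set \<times> 'a set \<times> 'a set) set" where
  "m_separations G =
     {(A, B, C). A \<subseteq> verts G \<and> B \<subseteq> verts G \<and> A \<noteq> {} \<and> B \<noteq> {} \<and> A \<inter> B = {} \<and>
        C \<subseteq> verts G - (A \<union> B) \<and> (\<forall>v\<in>A. \<forall>w\<in>B. m_separated G v w C)}"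

definition maximal_ancestral_graph :: "'a mixed_graph \<Rightarrow> bool" where
  "maximal_ancestral_graph G \<longleftrightarrow>
     ancestral_graph G \<and>
     (\<forall>v\<in>verts G. \<forall>w\<in>verts G. v \<noteq> w \<and> \<not> adjacent G v w \<longrightarrow>
        (\<exists>C. C \<subseteq> verts G - {v, w} \<and> m_separated G v w C))"

definition Markov_equivalent :: "'a mixed_graph \<Rightarrow> 'a mixed_graph \<Rightarrow> bool" where
  "Markov_equivalent G H \<longleftrightarrow> verts G = verts H \<and> m_separations G = m_separations H"

definition arrowheads :: "'a mixed_graph \<Rightarrow> nat" where
  "arrowheads G = card (dir_edges G) + 2 * card (bidir_edges G)"

definition minimally_oriented_graph :: "'a mixed_graph \<Rightarrow> 'a mixed_graph \<Rightarrow> bool" where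
  "minimally_oriented_graph G M \<longleftrightarrow>
     maximal_ancestral_graph M \<and>
     Markov_equivalent G M \<and>
     (\<forall>H. maximal_ancestral_graph H \<and> Markov_equivalent G H \<longrightarrow> arrowheads M \<le> arrowheads H)"

definition simplicial :: "'a mixed_graph \<Rightarrow> 'a \<Rightarrow> bool" where
  "simplicial G v \<longleftrightarrow> (\<forall>x\<in>Bd G v. \<forall>y\<in>Bd G v. x \<noteq> y \<longrightarrow> adjacent G x y)"

text \<open>All arrowheads at vertices in S are dropped simultaneously: a bi-directed edge loses one
  arrowhead for each of its endpoints in S.\<close>

definition drop_arrowheads_at :: "'a set \<Rightarrow> 'a mixed_graph \<Rightarrow> 'a mixed_graph" where
  "drop_arrowheads_at S G =
     \<lparr>verts = verts G,
      undir_edges = undir_edges G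
        \<union> {{v, w} | v w. (w, v) \<in> dir_edges G \<and> v \<in> S}
        \<union> {{v, w} | v w. {v, w} \<in> bidir_edges G \<and> v \<in> S \<and> w \<in> S},
      dir_edges = {(v, w). (v, w) \<in> dir_edges G \<and> w \<notin> S}
        \<union> {(v, w). {v, w} \<in> bidir_edges G \<and> v \<in> S \<and> w \<notin> S},
      bidir_edges = {e \<in> bidir_edges G. e \<inter> S = {}}\<rparr>"

definition simplicial_graph :: "'a mixed_graph \<Rightarrow> 'a mixed_graph" where
  "simplicial_graph G = drop_arrowheads_at {v \<in> verts G. simplicial G v} G"

definition Bd_order :: "'a mixed_graph \<Rightarrow> ('a \<times> 'a) set" where
  "Bd_order G = {(v, w). v \<in> verts G \<and> w \<in> verts G \<and> (v = w \<or> Bd G v \<subset> Bd G w)}"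

text \<open>The relation r is the reflexive total order; its strict part is r minus the identity.\<close>

definition min_orientable_edges :: "'a mixed_graph \<Rightarrow> ('a \<times> 'a) set \<Rightarrow> ('a \<times> 'a) set" where
  "min_orientable_edges G r =
     {(v, w). {v, w} \<in> bidir_edges (simplicial_graph G) \<and> Bd G v \<subseteq> Bd G w \<and> (v, w) \<in> r - Id}"

definition G_min :: "'a mixed_graph \<Rightarrow> ('a \<times> 'a) set \<Rightarrow> 'a mixed_graph" where
  "G_min G r =
     \<lparr>verts = verts G,
      undir_edges = undir_edges (simplicial_graph G),
      dir_edges = dir_edges (simplicial_graph G) \<union> min_orientable_edges G r,
      bidir_edges = bidir_edges (simplicial_graph G)
        - {{v, w} | v w. (v, w) \<in> min_orientable_edges G r}\<rparr>"

end

theory Submission imports Defs begin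

text \<open>In the oriented graph \<open>H\<close> a tail at \<open>v\<close> on the edge between \<open>v\<close> and \<open>w\<close> forces
  \<open>Bd v \<subseteq> Bd w\<close>, with boundaries taken in \<open>G\<close>; since \<open>H\<close> is ancestral, this yields
  Markov equivalence.
  Non-colliders of a connecting path of \<open>H\<close> can be bypassed along their tails and colliders
  replaced by descendants in \<open>C\<close>, while a shortest connecting path of \<open>G\<close>
  consists of colliders in \<open>H\<close>. Conversely, in every maximal ancestral graph equivalent to \<open>G\<close>
  each unshielded triple of \<open>G\<close> is a collider. Hence edges between vertices with incomparable
  boundaries stay bi-directed, and no undirected edge meets a non-simplicial vertex, so
  no such graph has fewer arrowheads than \<open>H\<close>.\<close>

section \<open>Adjacency, boundaries and edge marks in simple mixed graphs\<close>

lemma adjacent_commute: "adjacent G v w \<longleftrightarrow> adjacent G w v"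
  unfolding adjacent_def by (auto simp: insert_commute)

lemma mem_Bd_iff: "w \<in> Bd G v \<longleftrightarrow> w = v \<or> adjacent G v w"
  unfolding Bd_def by auto

lemma mem_Bd_commute: "w \<in> Bd G v \<longleftrightarrow> v \<in> Bd G w"
  using adjacent_commute by (fastforce simp: mem_Bd_iff)

lemma dir_edge_simple:
  assumes "simple_mixed_graph G" "(v, w) \<in> dir_edges G"
  shows "v \<in> verts G \<and> w \<in> verts G \<and> v \<noteq> w"
    and "(w, v) \<notin> dir_edges G \<and> {v, w} \<notin> undir_edges G \<and> {v, w} \<notin> bidir_edges G"
proof -
  have "\<forall>(v, w) \<in> dir_edges G. v \<in> verts G \<and> w \<in> verts G \<and> v \<noteq> w"
    and "\<forall>(v, w) \<in> dir_edges G. (w, v) \<notin> dir_edges G \<and> {v, w} \<notin> undir_edges G \<and> {v, w} \<notin> bidir_edges G"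
    using assms(1) by (simp_all add: simple_mixed_graph_def)
  then show "v \<in> verts G \<and> w \<in> verts G \<and> v \<noteq> w"
    and "(w, v) \<notin> dir_edges G \<and> {v, w} \<notin> undir_edges G \<and> {v, w} \<notin> bidir_edges G"
    using assms(2) by blast+
qed

lemma adjacent_simple:
  assumes "simple_mixed_graph G" "adjacent G v w"
  shows "v \<in> verts G \<and> w \<in> verts G \<and> v \<noteq> w"
proof -
  have un: "\<forall>e \<in> undir_edges G \<union> bidir_edges G. \<exists>a\<in>verts G. \<exists>b\<in>verts G. a \<noteq> b \<and> e = {a, b}"
    using assms(1) by (simp add: simple_mixed_graph_def)
  consider "{v, w} \<in> undir_edges G \<union> bidir_edges G" | "(v, w) \<in> dir_edges G" | "(w, v) \<in> dir_edges G"
    using assms(2) by (auto simp: adjacent_def)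
  then show ?thesis
  proof cases
    case 1
    then obtain a b where "a \<in> verts G" "b \<in> verts G" "a \<noteq> b" "{v, w} = {a, b}" using un by blast
    then show ?thesis by (auto simp: doubleton_eq_iff)
  qed (use dir_edge_simple[OF assms(1)] in blast)+
qed

lemma adjacent_not_refl: "simple_mixed_graph G \<Longrightarrow> \<not> adjacent G v v"
  using adjacent_simple by fast

lemma adjacent_in_verts:
  assumes "simple_mixed_graph G" "adjacent G v w"
  shows "v \<in> verts G" "w \<in> verts G"
  using adjacent_simple[OF assms] by simp_all

text \<open>All of \<open>Bd G v\<close> is pairwise adjacent, so each of its vertices equals or
  neighbours \<open>w\<close>. Tails created at simplicial vertices therefore respect boundary
  inclusion.\<close>

lemma simplicial_Bd_subset:
  assumes "simplicial G v" "adjacent G v w"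
  shows "Bd G v \<subseteq> Bd G w"
  using assms unfolding simplicial_def by (metis mem_Bd_iff subsetI)

lemma undir_no_arrowhead:
  assumes "ancestral_graph M" "{v, w} \<in> undir_edges M"
  shows "\<not> arrowhead_at M v u"
  using assms unfolding ancestral_graph_def arrowhead_at_def by (metis insert_commute)

lemma dir_edge_no_arrowhead:
  assumes "simple_mixed_graph M" "(v, w) \<in> dir_edges M"
  shows "\<not> arrowhead_at M v w"
  using dir_edge_simple(2)[OF assms] by (simp add: arrowhead_at_def)

lemma adjacent_not_separated:
  assumes "simple_mixed_graph M" "adjacent M v w"
  shows "\<not> m_separated M v w C"
proof -
  have "path_between M v [v, w] w"
    using assms adjacent_not_refl[OF assms(1)] adjacent_in_verts[OF assms] by (auto simp: path_between_def)
  moreover have "m_connecting M C [v, w]" by (simp add: m_connecting_def)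
  ultimately show ?thesis unfolding m_separated_def by blast
qed

section \<open>Connecting paths in bi-directed graphs\<close>

lemma nth_path_endpoint_iff:
  assumes "path_between G v p w" "i < length p"
  shows "p ! i = v \<longleftrightarrow> i = 0" "p ! i = w \<longleftrightarrow> Suc i = length p"
proof -
  have ne: "p \<noteq> []" and p: "v = p ! 0" "w = p ! (length p - 1)" and dist: "distinct p"
    using assms(1) by (auto simp: path_between_def hd_conv_nth last_conv_nth)
  have len: "0 < length p" "length p - 1 < length p" using ne by simp_all
  show "p ! i = v \<longleftrightarrow> i = 0"
    unfolding p by (rule nth_eq_iff_index_eq[OF dist assms(2) len(1)])
  have "p ! i = w \<longleftrightarrow> i = length p - 1"
    unfolding p by (rule nth_eq_iff_index_eq[OF dist assms(2) len(2)])
  then show "p ! i = w \<longleftrightarrow> Suc i = length p" using len(1) by arith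
qed

text \<open>Every inner vertex is a collider, and without directed edges \<open>An G C\<close> is
  just \<open>C\<close>. Phrasing the condition through \<open>set p\<close> rather than positions
  makes it easy to carry over when a path is shortened or extended.\<close>

lemma bidirected_m_connecting_iff:
  assumes "bidirected_graph G" "path_between G v p w"
  shows "m_connecting G C p \<longleftrightarrow> set p \<subseteq> insert v (insert w C)"
proof -
  have col: "collider G p i" if "0 < i" "i + 1 < length p" for i
  proof -
    have "adjacent G (p ! (i - 1)) (p ! i)" "adjacent G (p ! i) (p ! (i + 1))"
      using assms(2) that successively_nth[of "adjacent G" p i] successively_nth[of "adjacent G" p "i - 1"]
      by (auto simp: path_between_def)
    then show ?thesis
      using assms(1) by (auto simp: collider_def arrowhead_at_def adjacent_def bidirected_graph_def insert_commute)
  qed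
  have An: "An G C = C"
    using assms(1) by (auto simp: An_def ancestor_def bidirected_graph_def)
  have "m_connecting G C p \<longleftrightarrow> (\<forall>i < length p. 0 < i \<longrightarrow> Suc i \<noteq> length p \<longrightarrow> p ! i \<in> C)"
  proof -
    have "0 < i \<and> i + 1 < length p \<longleftrightarrow> i < length p \<and> 0 < i \<and> Suc i \<noteq> length p" for i by auto
    then show ?thesis using col An unfolding m_connecting_def by blast
  qed
  also have "\<dots> \<longleftrightarrow> (\<forall>i < length p. p ! i \<in> insert v (insert w C))"
    using nth_path_endpoint_iff[OF assms(2)] by auto
  also have "\<dots> \<longleftrightarrow> set p \<subseteq> insert v (insert w C)"
    by (auto simp: set_conv_nth)
  finally show ?thesis .
qed

text \<open>Given the empty set, a connecting path has no inner vertex and so would be an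
  edge.\<close>

lemma nonadjacent_separated_empty:
  assumes "bidirected_graph G" "v \<noteq> w" "\<not> adjacent G v w"
  shows "m_separated G v w {}"
  unfolding m_separated_def
proof (intro notI, elim exE conjE)
  fix p assume p: "path_between G v p w" and "m_connecting G {} p"
  then have sub: "set p \<subseteq> {v, w}" using bidirected_m_connecting_iff[OF assms(1) p] by simp
  obtain q where q: "p = v # q" "q \<noteq> []" "last q = w" "v \<notin> set q" "distinct q" "adjacent G v (hd q)"
    using p assms(2) by (cases p) (auto simp: path_between_def successively_Cons split: if_splits)
  then have "hd q = w" using sub by (cases q) auto
  then show False using q assms(3) by simp
qed

lemma rtrancl_imp_path:
  assumes "simple_mixed_graph G" "v \<in> verts G"
    and "(v, k) \<in> {(a, b). adjacent G a b \<and> b \<in> C}\<^sup>*"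
  shows "\<exists>p. path_between G v p k \<and> set p \<subseteq> insert v C"
  using assms(3)
proof induction
  case base
  have "path_between G v [v] v" using assms(2) by (simp add: path_between_def)
  then show ?case by (intro exI[of _ "[v]"]) auto
next
  case (step y z)
  then obtain p where p: "path_between G v p y" "set p \<subseteq> insert v C" by blast
  have yz: "adjacent G y z" "z \<in> C" using step by auto
  show ?case
  proof (cases "z \<in> set p")
    case True
    \<comment> \<open>The walk returns to a vertex of the path; cutting the path there avoids the
      repetition.\<close>
    then obtain a b where "p = a @ z # b" by (meson split_list)
    then have "path_between G v (a @ [z]) z \<and> set (a @ [z]) \<subseteq> insert v C"
      using p by (auto simp: path_between_def successively_append_iff hd_append)
    then show ?thesis by blast
  next
    case False
    then have "path_between G v (p @ [z]) z \<and> set (p @ [z]) \<subseteq> insert v C"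
      using p yz adjacent_in_verts[OF assms(1) yz(1)] by (auto simp: path_between_def successively_append_iff)
    then show ?thesis by blast
  qed
qed

text \<open>The relation restricts only the targets of its steps, because \<open>v\<close> itself
  need not lie in \<open>C\<close>. As \<open>w\<close> is outside \<open>C\<close> and differs from
  \<open>v\<close>, it is not yet on the path to \<open>k\<close> and can be appended.\<close>

lemma rtrancl_not_separated:
  assumes G: "bidirected_graph G" and v: "v \<in> verts G" "v \<noteq> w" "w \<notin> C"
    and k: "(v, k) \<in> {(a, b). adjacent G a b \<and> b \<in> C}\<^sup>*" "w \<in> Bd G k"
  shows "\<not> m_separated G v w C"
proof -
  have simple: "simple_mixed_graph G" using G by (simp add: bidirected_graph_def)
  obtain p where p: "path_between G v p k" "set p \<subseteq> insert v C"
    using rtrancl_imp_path[OF simple v(1) k(1)] by blast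
  have "k \<in> set p" using p(1) by (auto simp: path_between_def)
  then have "k \<noteq> w" using p(2) v by auto
  then have kw: "adjacent G k w" using k(2) by (auto simp: mem_Bd_iff)
  have "path_between G v (p @ [w]) w"
    using p v kw adjacent_in_verts[OF simple kw] by (auto simp: path_between_def successively_append_iff)
  moreover have "set (p @ [w]) \<subseteq> insert v (insert w C)" using p by auto
  ultimately show ?thesis
    using bidirected_m_connecting_iff[OF G] unfolding m_separated_def by blast
qed

section \<open>Markov equivalence when tails respect boundary inclusion\<close>

locale Bd_oriented =
  fixes G H :: "'a mixed_graph"
  assumes bidirected: "bidirected_graph G"
    and ancestral: "ancestral_graph H"
    and verts_eq: "verts H = verts G"
    and adjacent_eq: "adjacent H v w \<longleftrightarrow> adjacent G v w"
    and tail_Bd_subset: "adjacent G v w \<Longrightarrow> \<not> arrowhead_at H v w \<Longrightarrow> Bd G v \<subseteq> Bd G w"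
begin

lemma simple_G: "simple_mixed_graph G" and simple_H: "simple_mixed_graph H"
  using bidirected ancestral by (auto simp: bidirected_graph_def ancestral_graph_def)

lemma ancestor_Bd_subset:
  assumes "ancestor H v w"
  shows "Bd G v \<subseteq> Bd G w"
  using assms unfolding ancestor_def
proof induction
  case (step y z)
  have "adjacent H y z" using step by (simp add: adjacent_def)
  then have "Bd G y \<subseteq> Bd G z"
    using tail_Bd_subset[of y z] dir_edge_no_arrowhead[OF simple_H step(2)] adjacent_eq[of y z] by simp
  then show ?case using step by blast
qed simp

text \<open>The path of \<open>H\<close> need not connect in \<open>G\<close>. What is carried along
  it is only that each of its vertices can be reached in \<open>G\<close> from \<open>v\<close> by a
  walk with inner vertices in \<open>C\<close>; at \<open>w\<close> this gives a connecting path of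
  \<open>G\<close>.\<close>

lemma not_separated_imp:
  assumes v: "v \<noteq> w" "w \<notin> C" and "\<not> m_separated H v w C"
  shows "\<not> m_separated G v w C"
proof -
  obtain p where p: "path_between H v p w" and conn: "m_connecting H C p"
    using assms by (auto simp: m_separated_def)
  define R where "R = {(a, b). adjacent G a b \<and> b \<in> C}\<^sup>*"
  \<comment> \<open>\<open>B\<close> holds the vertices reached from \<open>v\<close> by steps into
    \<open>C\<close>, followed by at most one further step to an arbitrary neighbour.\<close>
  define B where "B = (\<Union>k \<in> {k. (v, k) \<in> R}. Bd G k)"
  have p': "p \<noteq> []" "p ! 0 = v" "p ! (length p - 1) = w"
    using p by (auto simp: path_between_def hd_conv_nth last_conv_nth)
  have adj: "adjacent G (p ! i) (p ! Suc i)" if "Suc i < length p" for i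
    using p successively_nth[of "adjacent H" p i] that adjacent_eq by (auto simp: path_between_def)
  have Bv: "Bd G v \<subseteq> B" by (auto simp: B_def R_def)
  \<comment> \<open>The second conjunct is what carries the walk past a vertex whose only tail points backwards.\<close>
  have "p ! i \<in> B \<and> (0 < i \<and> \<not> arrowhead_at H (p ! i) (p ! (i - 1)) \<longrightarrow> Bd G (p ! i) \<subseteq> B)"
    if "i < length p" for i
    using that
  proof (induction i)
    case 0
    then show ?case using p' Bv by (auto simp: mem_Bd_iff)
  next
    case (Suc i)
    let ?x = "p ! i" and ?y = "p ! Suc i"
    have xy: "adjacent G ?x ?y" using adj Suc by simp
    have IH: "?x \<in> B" "0 < i \<Longrightarrow> \<not> arrowhead_at H ?x (p ! (i - 1)) \<Longrightarrow> Bd G ?x \<subseteq> B"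
      using Suc by auto
    have tail: "\<not> arrowhead_at H ?y ?x \<Longrightarrow> Bd G ?y \<subseteq> Bd G ?x"
      using tail_Bd_subset[of ?y ?x] xy adjacent_commute[of G ?x ?y] by simp
    \<comment> \<open>At the start of the path, or after a backward tail at \<open>?x\<close>, the
      whole boundary is already in \<open>B\<close>. Otherwise the edge behind has an arrowhead at
      \<open>?x\<close>, and the mark ahead decides between the other two cases.\<close>
    consider (inB) "Bd G ?x \<subseteq> B"
      | (forw) "0 < i" "arrowhead_at H ?x (p ! (i - 1))" "\<not> arrowhead_at H ?x ?y"
      | (coll) "0 < i" "collider H p i"
      using IH(2) Bv p'(2) unfolding collider_def by (metis not_gr_zero Suc_eq_plus1)
    then show ?case
    proof cases
      case inB
      then show ?thesis using tail xy by (auto simp: mem_Bd_iff)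
    next
      case forw
      obtain k where k: "(v, k) \<in> R" "?x \<in> Bd G k" using IH(1) by (auto simp: B_def)
      have "Bd G ?x \<subseteq> Bd G ?y" using tail_Bd_subset[OF xy] forw by simp
      \<comment> \<open>By symmetry \<open>k\<close> lies in \<open>Bd G ?x\<close> and hence in
        \<open>Bd G ?y\<close>, so \<open>?x\<close> is bypassed: \<open>?y\<close> is reached
        directly from the same \<open>k\<close>.\<close>
      then have "?y \<in> Bd G k" using k(2) mem_Bd_commute[of _ G k] by blast
      then have "?y \<in> B" using k(1) by (auto simp: B_def)
      \<comment> \<open>An undirected edge cannot meet the arrowhead at \<open>?x\<close>, so the
        edge points at \<open>?y\<close> and the second conjunct is vacuous there.\<close>
      moreover have "{?x, ?y} \<notin> undir_edges H" using undir_no_arrowhead[OF ancestral] forw by blast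
      then have "(?x, ?y) \<in> dir_edges H"
        using xy forw(3) adjacent_eq[of ?x ?y] by (auto simp: adjacent_def arrowhead_at_def)
      then have "arrowhead_at H ?y ?x" by (simp add: arrowhead_at_def)
      ultimately show ?thesis by simp
    next
      case coll
      then obtain c where c: "c \<in> C" "ancestor H ?x c"
        using conn Suc.prems by (auto simp: m_connecting_def An_def)
      have sub: "Bd G ?x \<subseteq> Bd G c" using ancestor_Bd_subset c by blast
      obtain k where k: "(v, k) \<in> R" "?x \<in> Bd G k" using IH(1) by (auto simp: B_def)
      \<comment> \<open>The collider is replaced by its descendant \<open>c\<close>: since
        \<open>c\<close> has the larger boundary, it equals or neighbours \<open>k\<close>, and
        being in \<open>C\<close> it is reachable itself.\<close>
      have "c \<in> Bd G k" using k(2) sub mem_Bd_commute[of k G] by blast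
      then have "c = k \<or> (k, c) \<in> {(a, b). adjacent G a b \<and> b \<in> C}" using c by (auto simp: mem_Bd_iff)
      then have "(v, c) \<in> R" using k(1) unfolding R_def by (auto intro: rtrancl_into_rtrancl)
      then have "Bd G ?x \<subseteq> B" using sub by (auto simp: B_def)
      then show ?thesis using tail xy by (auto simp: mem_Bd_iff)
    qed
  qed
  from this[of "length p - 1"] have "w \<in> B" using p' by simp
  moreover have "v \<in> verts G" using p verts_eq by (auto simp: path_between_def)
  ultimately show ?thesis
    using rtrancl_not_separated[OF bidirected _ v] by (auto simp: B_def R_def)
qed

text \<open>A shortest connecting path of \<open>G\<close> has no chord between vertices at distance two, so in
  \<open>H\<close> no inner vertex of it can have a tail.\<close>

lemma separated_imp:
  assumes "\<not> m_separated G v w C"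
  shows "\<not> m_separated H v w C"
proof -
  let ?P = "\<lambda>p. path_between G v p w \<and> m_connecting G C p"
  obtain p where p: "path_between G v p w" "m_connecting G C p"
      and least: "\<And>q. ?P q \<Longrightarrow> length p \<le> length q"
    using assms ex_has_least_nat[of ?P _ length] unfolding m_separated_def by blast
  have set_p: "set p \<subseteq> insert v (insert w C)"
    using bidirected_m_connecting_iff[OF bidirected] p by blast
  have inner: "collider H p i \<and> p ! i \<in> C" if i: "0 < i" "i + 1 < length p" for i
  proof -
    define x u y where "x = p ! (i - 1)" and "u = p ! i" and "y = p ! (i + 1)"
    define a b where "a = take (i - 1) p" and "b = drop (i + 2) p"
    have split: "p = a @ [x, u, y] @ b"
      using i unfolding a_def b_def x_def u_def y_def
      by (metis (no_types, lifting) Cons_nth_drop_Suc Suc_diff_1 Suc_eq_plus1 add_2_eq_Suc' append_Cons append_Nil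
          append_take_drop_id diff_less_mono2 less_Suc_eq less_trans zero_less_one Suc_lessD)
    have adj: "adjacent G x u" "adjacent G u y" "x \<noteq> y"
      using p(1) by (auto simp: path_between_def split successively_append_iff)
    have "\<not> adjacent G x y"
    proof
      assume "adjacent G x y"
      then have "successively (adjacent G) (a @ [x, y] @ b)"
        using p(1) by (simp add: path_between_def split successively_append_iff successively_Cons)
      then have path: "path_between G v (a @ [x, y] @ b) w"
        using p(1) by (auto simp: path_between_def split hd_append)
      \<comment> \<open>Leaving out \<open>u\<close> only shrinks the vertex set, so the shortcut
        still connects, against minimality.\<close>
      moreover have "m_connecting G C (a @ [x, y] @ b)"
        using set_p bidirected_m_connecting_iff[OF bidirected path] by (auto simp: split)
      ultimately show False using least[of "a @ [x, y] @ b"] by (simp add: split)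
    qed
    then have "y \<notin> Bd G x" "x \<notin> Bd G y" using adj adjacent_commute by (fastforce simp: mem_Bd_iff)+
    moreover have "x \<in> Bd G u" "y \<in> Bd G u" using adj adjacent_commute by (fastforce simp: mem_Bd_iff)+
    \<comment> \<open>\<open>Bd G u\<close> contains both \<open>x\<close> and \<open>y\<close>,
      hence is included in neither \<open>Bd G x\<close> nor \<open>Bd G y\<close>; a tail at
      \<open>u\<close> would force one of these inclusions.\<close>
    ultimately have "arrowhead_at H u x" "arrowhead_at H u y"
      using tail_Bd_subset[of u] adj adjacent_commute by (metis subsetD)+
    then have "collider H p i" by (simp add: collider_def x_def u_def y_def)
    moreover have "p ! i \<in> C"
      using nth_path_endpoint_iff[OF p(1), of i] i subsetD[OF set_p nth_mem[of i p]] by auto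
    ultimately show ?thesis by blast
  qed
  have "C \<subseteq> An H C" by (auto simp: An_def ancestor_def)
  then have "m_connecting H C p" using inner unfolding m_connecting_def by blast
  moreover have "path_between H v p w"
    using p(1) adjacent_eq verts_eq by (simp add: path_between_def successively_conv_nth)
  ultimately show ?thesis unfolding m_separated_def by blast
qed

lemma m_separated_iff:
  assumes "v \<noteq> w" "w \<notin> C"
  shows "m_separated H v w C \<longleftrightarrow> m_separated G v w C"
  using not_separated_imp[OF assms] separated_imp by blast

lemma Markov_equivalent: "Markov_equivalent G H"
proof -
  have sep: "(\<forall>v\<in>A. \<forall>w\<in>B. m_separated G v w C) \<longleftrightarrow> (\<forall>v\<in>A. \<forall>w\<in>B. m_separated H v w C)"
    if "A \<inter> B = {}" "C \<subseteq> verts G - (A \<union> B)" for A B C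
  proof (intro ball_cong refl)
    fix v w assume "v \<in> A" "w \<in> B"
    then have "v \<noteq> w" "w \<notin> C" using that by auto
    then show "m_separated G v w C = m_separated H v w C" using m_separated_iff by simp
  qed
  have "(A, B, C) \<in> m_separations G \<longleftrightarrow> (A, B, C) \<in> m_separations H" for A B C
    using sep[of A B C] by (simp add: m_separations_def verts_eq cong: conj_cong)
  then show ?thesis
    unfolding Markov_equivalent_def verts_eq by auto
qed

text \<open>The empty set separates every nonadjacent pair in \<open>G\<close>, hence also in
  \<open>H\<close>, which has the same adjacencies.\<close>

lemma maximal: "maximal_ancestral_graph H"
  unfolding maximal_ancestral_graph_def adjacent_eq
proof (intro conjI ballI impI exI[of _ "{}"])
  fix v w assume "v \<noteq> w \<and> \<not> adjacent G v w"
  then show "m_separated H v w {}"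
    using m_separated_iff[of v w "{}"] nonadjacent_separated_empty[OF bidirected] by simp
qed (use ancestral in auto)

end

section \<open>Constraints on equivalent maximal ancestral graphs\<close>

context
  fixes G M :: "'a mixed_graph"
  assumes G: "bidirected_graph G" and M: "maximal_ancestral_graph M" and eq: "Markov_equivalent G M"
begin

text \<open>Equivalence compares triples of sets; singletons recover the statement for pairs of
  vertices.\<close>

lemma m_separated_transfer:
  assumes "v \<in> verts G" "w \<in> verts G" "v \<noteq> w" "C \<subseteq> verts G - {v, w}"
  shows "m_separated G v w C \<longleftrightarrow> m_separated M v w C"
proof -
  have "({v}, {w}, C) \<in> m_separations G \<longleftrightarrow> ({v}, {w}, C) \<in> m_separations M"
    and "verts M = verts G"
    using eq by (auto simp: Markov_equivalent_def)
  then show ?thesis using assms by (auto simp: m_separations_def)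
qed

text \<open>By maximality a missing edge of \<open>M\<close> comes with a separating set, which
  would then separate adjacent vertices of \<open>G\<close>.\<close>

lemma adjacent_equivalent_graph:
  assumes "adjacent G v w"
  shows "adjacent M v w"
proof (rule ccontr)
  assume "\<not> adjacent M v w"
  have simple: "simple_mixed_graph G" using G by (simp add: bidirected_graph_def)
  have vw: "v \<in> verts G" "w \<in> verts G" "v \<noteq> w"
    using adjacent_in_verts[OF simple assms] adjacent_not_refl[OF simple] assms by auto
  have V: "verts M = verts G" using eq by (simp add: Markov_equivalent_def)
  obtain C where "C \<subseteq> verts M - {v, w}" "m_separated M v w C"
    using M vw \<open>\<not> adjacent M v w\<close> unfolding maximal_ancestral_graph_def V by blast
  then show False
    using m_separated_transfer[OF vw] adjacent_not_separated[OF simple assms] V by simp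
qed

text \<open>The empty set separates \<open>x\<close> and \<open>y\<close> in \<open>G\<close>, hence
  in \<open>M\<close>, so it must block the path \<open>[x, v, y]\<close>. A non-collider is never
  blocked by the empty set.\<close>

lemma unshielded_collider:
  assumes "adjacent G x v" "adjacent G v y" "x \<noteq> y" "\<not> adjacent G x y"
  shows "arrowhead_at M v x \<and> arrowhead_at M v y"
proof -
  have simple: "simple_mixed_graph G" using G by (simp add: bidirected_graph_def)
  have V: "verts M = verts G" using eq by (simp add: Markov_equivalent_def)
  have in_V: "x \<in> verts G" "v \<in> verts G" "y \<in> verts G" "x \<noteq> v" "v \<noteq> y"
    using adjacent_in_verts[OF simple] adjacent_not_refl[OF simple] assms by metis+
  have path: "path_between M x [x, v, y] y"
    using in_V V assms adjacent_equivalent_graph by (auto simp: path_between_def)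
  have "m_separated M x y {}"
    using m_separated_transfer in_V assms nonadjacent_separated_empty[OF G] by blast
  then have "\<not> m_connecting M {} [x, v, y]" using path by (auto simp: m_separated_def)
  then obtain i where "0 < i" "i + 1 < length [x, v, y]" "collider M [x, v, y] i"
    unfolding m_connecting_def by auto
  then have "collider M [x, v, y] 1" by (simp add: less_Suc_eq)
  then show ?thesis by (simp add: collider_def)
qed

text \<open>A vertex of \<open>Bd G v\<close> outside \<open>Bd G w\<close> forms an unshielded
  triple with \<open>v\<close> and \<open>w\<close>.\<close>

lemma Bd_not_subset_arrowhead:
  assumes "adjacent G v w" "\<not> Bd G v \<subseteq> Bd G w"
  shows "arrowhead_at M v w"
proof -
  obtain x where "x \<in> Bd G v" "x \<notin> Bd G w" using assms by blast
  then show ?thesis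
    using unshielded_collider[of x v w] assms adjacent_commute[of G] by (auto simp: mem_Bd_iff)
qed

text \<open>Two nonadjacent vertices of \<open>Bd G v\<close> make \<open>v\<close> an unshielded
  collider, and in an ancestral graph no undirected edge meets an arrowhead.\<close>

lemma nonsimplicial_not_undir:
  assumes "\<not> simplicial G v"
  shows "{v, w} \<notin> undir_edges M"
proof -
  obtain x y where "x \<in> Bd G v" "y \<in> Bd G v" "x \<noteq> y" "\<not> adjacent G x y"
    using assms by (auto simp: simplicial_def)
  then have "arrowhead_at M v x"
    using unshielded_collider[of x v y] adjacent_commute[of G] by (auto simp: mem_Bd_iff)
  then show ?thesis
    using undir_no_arrowhead M unfolding maximal_ancestral_graph_def by metis
qed

end

section \<open>Counting arrowheads\<close>

text \<open>Splits d + 2b as (d + b) + b. Directed edges become unordered pairs, so that graphs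
  directing an edge in opposite ways can be compared by set inclusion.\<close>

lemma arrowheads_conv_card:
  assumes "simple_mixed_graph M"
  shows "arrowheads M =
    card ((\<lambda>(v, w). {v, w}) ` dir_edges M \<union> bidir_edges M) + card (bidir_edges M)"
    and "finite ((\<lambda>(v, w). {v, w}) ` dir_edges M \<union> bidir_edges M)"
proof -
  have "dir_edges M \<subseteq> verts M \<times> verts M"
    using dir_edge_simple(1)[OF assms] by auto
  moreover have "bidir_edges M \<subseteq> Pow (verts M)"
  proof
    fix e assume "e \<in> bidir_edges M"
    then obtain v w where "v \<in> verts M" "w \<in> verts M" "e = {v, w}"
      using assms unfolding simple_mixed_graph_def by blast
    then show "e \<in> Pow (verts M)" by simp
  qed
  moreover have "finite (verts M)" using assms by (simp add: simple_mixed_graph_def)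
  ultimately have fin: "finite (dir_edges M)" "finite (bidir_edges M)"
    by (meson finite_subset finite_SigmaI finite_Pow_iff)+
  then show "finite ((\<lambda>(v, w). {v, w}) ` dir_edges M \<union> bidir_edges M)" by simp
  have "inj_on (\<lambda>(v, w). {v, w}) (dir_edges M)"
    using dir_edge_simple(2)[OF assms] by (auto simp: inj_on_def doubleton_eq_iff)
  moreover have "(\<lambda>(v, w). {v, w}) ` dir_edges M \<inter> bidir_edges M = {}"
    using dir_edge_simple(2)[OF assms] by auto
  ultimately show "arrowheads M =
    card ((\<lambda>(v, w). {v, w}) ` dir_edges M \<union> bidir_edges M) + card (bidir_edges M)"
    using fin by (simp add: arrowheads_def card_Un_disjoint card_image)
qed

section \<open>The graph \<open>G_min G r\<close> and its minimality\<close>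

locale min_orientation =
  fixes G :: "'a mixed_graph" and r :: "('a \<times> 'a) set"
  assumes bidirected: "bidirected_graph G"
    and linear: "linear_order_on (verts G) r"
    and extends: "Bd_order G \<subseteq> r"
begin

abbreviation (input) H where "H \<equiv> G_min G r"

lemma simple_G: "simple_mixed_graph G"
  using bidirected by (simp add: bidirected_graph_def)

lemma bidir_iff_adjacent: "{v, w} \<in> bidir_edges G \<longleftrightarrow> adjacent G v w"
  using bidirected by (auto simp: adjacent_def bidirected_graph_def)

lemma verts_H: "verts H = verts G"
  by (simp add: G_min_def)

lemma undir_iff: "{v, w} \<in> undir_edges H \<longleftrightarrow> adjacent G v w \<and> simplicial G v \<and> simplicial G w"
proof -
  have "{v, w} \<in> undir_edges H \<longleftrightarrow>
      adjacent G v w \<and> v \<in> verts G \<and> simplicial G v \<and> w \<in> verts G \<and> simplicial G w"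
    using bidirected bidir_iff_adjacent adjacent_commute[of G v w]
    by (auto simp: G_min_def simplicial_graph_def drop_arrowheads_at_def bidirected_graph_def doubleton_eq_iff
        insert_commute)
  then show ?thesis using adjacent_in_verts[OF simple_G] by blast
qed

text \<open>Treats both sources of directed edges uniformly: for a dropped arrowhead the inclusion
  holds because \<open>v\<close> is simplicial, for an edge oriented by \<open>r\<close> it is
  required.\<close>

lemma dir_iff:
  "(v, w) \<in> dir_edges H \<longleftrightarrow>
     adjacent G v w \<and> Bd G v \<subseteq> Bd G w \<and> \<not> simplicial G w \<and> (simplicial G v \<or> (v, w) \<in> r - Id)"
proof -
  have "(v, w) \<in> dir_edges H \<longleftrightarrow> adjacent G v w \<and> v \<in> verts G \<and> w \<in> verts G \<and>
      (simplicial G v \<and> \<not> simplicial G w \<or>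
       \<not> simplicial G v \<and> \<not> simplicial G w \<and> Bd G v \<subseteq> Bd G w \<and> (v, w) \<in> r - Id)"
    using bidirected bidir_iff_adjacent adjacent_in_verts[OF simple_G, of v w]
    by (auto simp: G_min_def simplicial_graph_def drop_arrowheads_at_def bidirected_graph_def
        min_orientable_edges_def)
  then show ?thesis
    using adjacent_in_verts[OF simple_G, of v w] simplicial_Bd_subset by metis
qed

text \<open>As \<open>r\<close> extends strict inclusion of boundaries, it never opposes an
  inclusion, and equal boundaries are ordered by totality. So comparable boundaries always cost the
  edge an arrowhead.\<close>

lemma incomparable_iff:
  assumes "adjacent G v w"
  shows "\<not> Bd G v \<subseteq> Bd G w \<and> \<not> Bd G w \<subseteq> Bd G v \<longleftrightarrow>
    \<not> simplicial G v \<and> \<not> simplicial G w \<and>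
    \<not> (Bd G v \<subseteq> Bd G w \<and> (v, w) \<in> r - Id) \<and> \<not> (Bd G w \<subseteq> Bd G v \<and> (w, v) \<in> r - Id)"
proof -
  have vw: "v \<in> verts G" "w \<in> verts G" "v \<noteq> w" "adjacent G w v"
    using adjacent_in_verts[OF simple_G assms] adjacent_not_refl[OF simple_G] assms adjacent_commute[of G]
    by auto
  have "(v, w) \<in> r \<or> (w, v) \<in> r"
    using linear vw by (auto simp: linear_order_on_def total_on_def)
  moreover have "Bd G v \<subset> Bd G w \<Longrightarrow> (v, w) \<in> r" "Bd G w \<subset> Bd G v \<Longrightarrow> (w, v) \<in> r"
    using extends vw by (auto simp: Bd_order_def)
  ultimately show ?thesis
    using vw simplicial_Bd_subset assms by (metis DiffI pair_in_Id_conv psubsetI)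
qed

text \<open>The remaining bi-directed edges do not depend on \<open>r\<close>.\<close>

lemma bidir_iff:
  "{v, w} \<in> bidir_edges H \<longleftrightarrow> adjacent G v w \<and> \<not> Bd G v \<subseteq> Bd G w \<and> \<not> Bd G w \<subseteq> Bd G v"
proof -
  have "{v, w} \<in> bidir_edges H \<longleftrightarrow> adjacent G v w \<and> \<not> simplicial G v \<and> \<not> simplicial G w \<and>
    \<not> (Bd G v \<subseteq> Bd G w \<and> (v, w) \<in> r - Id) \<and> \<not> (Bd G w \<subseteq> Bd G v \<and> (w, v) \<in> r - Id)"
    using bidir_iff_adjacent adjacent_in_verts[OF simple_G, of v w] adjacent_commute[of G v w]
    by (auto simp: G_min_def simplicial_graph_def drop_arrowheads_at_def min_orientable_edges_def
        doubleton_eq_iff insert_commute)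
  then show ?thesis using incomparable_iff by blast
qed

lemma bidir_edges_doubleton: "e \<in> bidir_edges H \<Longrightarrow> \<exists>v w. e = {v, w}"
proof -
  assume "e \<in> bidir_edges H"
  then have "e \<in> bidir_edges G" by (simp add: G_min_def simplicial_graph_def drop_arrowheads_at_def)
  then show ?thesis using simple_G unfolding simple_mixed_graph_def by blast
qed

lemma undir_edges_doubleton: "e \<in> undir_edges H \<Longrightarrow> \<exists>v w. e = {v, w}"
  using bidirected by (auto simp: G_min_def simplicial_graph_def drop_arrowheads_at_def bidirected_graph_def)

lemma adjacent_H: "adjacent H v w \<longleftrightarrow> adjacent G v w"
proof
  show "adjacent H v w \<Longrightarrow> adjacent G v w"
    using undir_iff dir_iff bidir_iff adjacent_commute[of G] by (auto simp: adjacent_def[of H])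
next
  assume vw: "adjacent G v w"
  have "{v, w} \<in> bidir_edges H \<or> {v, w} \<in> undir_edges H \<or> (v, w) \<in> dir_edges H \<or> (w, v) \<in> dir_edges H"
    using vw incomparable_iff[OF vw] adjacent_commute[of G v w] simplicial_Bd_subset[of G]
    unfolding undir_iff dir_iff bidir_iff by blast
  then show "adjacent H v w" by (auto simp: adjacent_def)
qed

lemma dir_asym: "(v, w) \<in> dir_edges H \<Longrightarrow> (w, v) \<notin> dir_edges H"
  using linear unfolding dir_iff linear_order_on_def partial_order_on_def antisym_def by blast

lemma simple_H: "simple_mixed_graph H"
proof -
  have edge: "\<exists>v\<in>verts H. \<exists>w\<in>verts H. v \<noteq> w \<and> e = {v, w}" if "e \<in> undir_edges H \<union> bidir_edges H" for e
  proof -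
    obtain v w where e: "e = {v, w}" using \<open>e \<in> _\<close> undir_edges_doubleton bidir_edges_doubleton by blast
    then have "adjacent G v w" using that undir_iff bidir_iff by auto
    then show ?thesis
      using e adjacent_simple[OF simple_G] unfolding verts_H by blast
  qed
  have disj: "undir_edges H \<inter> bidir_edges H = {}"
  proof (intro equals0I, elim IntE)
    fix e assume e: "e \<in> undir_edges H" "e \<in> bidir_edges H"
    then obtain v w where "e = {v, w}" using undir_edges_doubleton by blast
    then show False using e undir_iff[of v w] bidir_iff[of v w] simplicial_Bd_subset[of G v w] by simp
  qed
  have "v \<in> verts H \<and> w \<in> verts H \<and> v \<noteq> w \<and> (w, v) \<notin> dir_edges H \<and> {v, w} \<notin> undir_edges H \<and>
      {v, w} \<notin> bidir_edges H" if vw: "(v, w) \<in> dir_edges H" for v w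
  proof -
    have "adjacent G v w" "\<not> simplicial G w" "Bd G v \<subseteq> Bd G w" using vw by (auto simp: dir_iff)
    then show ?thesis
      using dir_asym[OF vw] adjacent_simple[OF simple_G]
      by (auto simp: verts_H undir_iff bidir_iff)
  qed
  moreover have "finite (verts H)" using simple_G by (simp add: verts_H simple_mixed_graph_def)
  ultimately show ?thesis unfolding simple_mixed_graph_def using edge disj by blast
qed

text \<open>The conditions of \<open>dir_iff\<close> other than adjacency are transitive: an
  intermediate vertex is not simplicial, so the edge leaving it follows \<open>r\<close> strictly.
  They are contradictory for \<open>v = w\<close>, which gives acyclicity.\<close>

lemma trancl_dir:
  assumes "(v, w) \<in> (dir_edges H)\<^sup>+"
  shows "Bd G v \<subseteq> Bd G w \<and> \<not> simplicial G w \<and> (simplicial G v \<or> (v, w) \<in> r - Id)"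
  using assms
proof induction
  case (step y z)
  have "trans r" "antisym r" using linear by (auto simp: linear_order_on_def partial_order_on_def preorder_on_def)
  then show ?case using step unfolding dir_iff trans_def antisym_def by blast
qed (simp add: dir_iff)

lemma ancestral_H: "ancestral_graph H"
  unfolding ancestral_graph_def
proof (intro conjI allI impI)
  show "simple_mixed_graph H" by (rule simple_H)
  show "acyclic (dir_edges H)" unfolding acyclic_def using trancl_dir by blast
  fix v w
  show "\<not> (\<exists>u. (u, v) \<in> dir_edges H \<or> {u, v} \<in> bidir_edges H)" if "{v, w} \<in> undir_edges H"
    using that simplicial_Bd_subset[of G v] adjacent_commute[of G] unfolding undir_iff dir_iff bidir_iff by blast
  show "\<not> ancestor H v w" if "{v, w} \<in> bidir_edges H"
    using that trancl_dir unfolding bidir_iff ancestor_def rtrancl_eq_or_trancl by blast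
qed

sublocale Bd_oriented G H
proof
  fix v w assume vw: "adjacent G v w" and "\<not> arrowhead_at H v w"
  then have "(w, v) \<notin> dir_edges H" "{v, w} \<notin> bidir_edges H" by (auto simp: arrowhead_at_def)
  \<comment> \<open>A tail at \<open>v\<close> lies on an undirected edge, where \<open>v\<close> is
    simplicial, or on an edge directed out of \<open>v\<close>; both give the inclusion.\<close>
  then have "{v, w} \<in> undir_edges H \<or> (v, w) \<in> dir_edges H"
    using vw adjacent_H[of v w] by (auto simp: adjacent_def)
  then show "Bd G v \<subseteq> Bd G w" using simplicial_Bd_subset[of G v w] by (auto simp only: undir_iff dir_iff)
qed (use bidirected ancestral_H verts_H adjacent_H in auto)

text \<open>Both summands of \<open>arrowheads_conv_card\<close> grow from \<open>H\<close> to
  \<open>M\<close>: bi-directed edges of \<open>H\<close> stay bi-directed, and edges with some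
  arrowhead keep at least one.\<close>

lemma arrowheads_minimal:
  assumes M: "maximal_ancestral_graph M" and eq: "Markov_equivalent G M"
  shows "arrowheads H \<le> arrowheads M"
proof -
  have simple_M: "simple_mixed_graph M"
    using M by (simp add: maximal_ancestral_graph_def ancestral_graph_def)
  let ?e = "\<lambda>(v, w). {v, w}"
  have bidir: "bidir_edges H \<subseteq> bidir_edges M"
  proof
    fix e assume e: "e \<in> bidir_edges H"
    then obtain v w where vw: "e = {v, w}" using bidir_edges_doubleton by blast
    then have "arrowhead_at M v w" "arrowhead_at M w v"
      using e Bd_not_subset_arrowhead[OF bidirected M eq] adjacent_commute[of G] by (auto simp: bidir_iff)
    then show "e \<in> bidir_edges M"
      using vw dir_edge_no_arrowhead[OF simple_M] by (auto simp: arrowhead_at_def insert_commute)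
  qed
  \<comment> \<open>The head \<open>w\<close> is not simplicial, so the edge is not undirected in
    \<open>M\<close>; its direction there may be reversed.\<close>
  have dir: "?e ` dir_edges H \<subseteq> ?e ` dir_edges M \<union> bidir_edges M"
  proof clarify
    fix v w assume vw: "(v, w) \<in> dir_edges H" and "{v, w} \<notin> bidir_edges M"
    then have "adjacent M v w" "{w, v} \<notin> undir_edges M"
      using adjacent_equivalent_graph[OF bidirected M eq] nonsimplicial_not_undir[OF bidirected M eq]
      by (auto simp: dir_iff)
    then have "(v, w) \<in> dir_edges M \<or> (w, v) \<in> dir_edges M"
      using \<open>{v, w} \<notin> bidir_edges M\<close> by (auto simp: adjacent_def insert_commute)
    then show "{v, w} \<in> ?e ` dir_edges M" by (force simp: insert_commute)
  qed
  have "card (?e ` dir_edges H \<union> bidir_edges H) \<le> card (?e ` dir_edges M \<union> bidir_edges M)"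
    using bidir dir arrowheads_conv_card(2)[OF simple_M] by (intro card_mono) auto
  moreover have "card (bidir_edges H) \<le> card (bidir_edges M)"
    using bidir arrowheads_conv_card(2)[OF simple_M] by (intro card_mono) auto
  ultimately show ?thesis
    using arrowheads_conv_card(1)[OF simple_M] arrowheads_conv_card(1)[OF simple_H] by simp
qed

end

theorem theorem16:
  fixes G :: "'a mixed_graph" and r :: "('a \<times> 'a) set"
  assumes "bidirected_graph G"
    and "linear_order_on (verts G) r"
    and "Bd_order G \<subseteq> r"
  shows "minimally_oriented_graph G (G_min G r)"
proof -
  interpret min_orientation G r using assms by unfold_locales
  show ?thesis
    unfolding minimally_oriented_graph_def using maximal Markov_equivalent arrowheads_minimal by blast
qed

end
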